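(* Let $\lambda$ be a nonzero real number and let $n,k\in\mathbb{N}=\{1,2,3,\dots\}$ be such that $\binom{\lambda-1}{k}\neq 0$ (i.e. $\lambda\notin\{1,2,\dots,k\}$). Then $$H_{n,\lambda}^{(k+1)}=\frac{(-1)^{k}}{\binom{\lambda-1}{k}}\binom{n+k}{n}\big(H_{n+k,\lambda}-H_{k,\lambda}\big).$$
   Context: For real $x$ and an integer $m\ge 0$, $\binom{x}{m}=\frac{x(x-1)\cdots(x-m+1)}{m!}$ is the generalized binomial coefficient (with $\binom{x}{0}=1$). For nonzero real $\lambda$, the degenerate harmonic numbers are defined by $H_{0,\lambda}=0$ and $H_{n,\lambda}=\sum_{j=1}^{n}\frac{1}{\lambda}\binom{\lambda}{j}(-1)^{j-1}$ for $n\ge 1$. The degenerate hyperharmonic numbers $H_{n,\lambda}^{(r)}$ ($n\ge 0$, $r\ge 1$) are defined by $H_{0,\lambda}^{(r)}=0$, $H_{n,\lambda}^{(1)}=H_{n,\lambda}$, and $H_{n,\lambda}^{(r)}=\sum_{j=1}^{n}H_{j,\lambda}^{(r-1)}$ for $r\ge 2$. *)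

theory Defs
  imports Complex_Main
begin

definition deg_harmonic :: "real \<Rightarrow> nat \<Rightarrow> real" where
  "deg_harmonic l n = (\<Sum>j = 1..n. 1 / l * (l gchoose j) * (-1) ^ (j - 1))"

(* deg_hyperharmonic l r n is the number of order r and index n. Orders start at 1;
   the value at order 0 is a dummy that no other clause refers to. The value 0 at
   index 0 is the empty sum. *)
fun deg_hyperharmonic :: "real \<Rightarrow> nat \<Rightarrow> nat \<Rightarrow> real" where
  "deg_hyperharmonic l 0 n = 0"
| "deg_hyperharmonic l (Suc 0) n = deg_harmonic l n"
| "deg_hyperharmonic l (Suc (Suc r)) n = (\<Sum>j = 1..n. deg_hyperharmonic l (Suc r) j)"

end

theory Submission
  imports Defs
begin

text \<open>
  Summing the alternating binomial coefficients of \<open>l\<close> repeatedly only lowers the upper argument,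
  so the hyperharmonic numbers have a closed form.
  Multiplying by \<open>(l - 1) gchoose k\<close> and applying trinomial revision
  turns the closed form into the difference of two harmonic numbers.
\<close>

text \<open>By Pascal's rule the alternating sum over all \<open>j \<le> n\<close> telescopes;
  starting at \<open>j = 1\<close> omits only the term 1, which becomes the constant here.\<close>

lemma deg_harmonic_closed_form:
  "deg_harmonic l n = (1 - (-1) ^ n * ((l - 1) gchoose n)) / l"
proof -
  have "(\<Sum>j = 1..n. (l gchoose j) * (-1) ^ (j - 1)) = - (\<Sum>j = 1..n. (l gchoose j) * (-1) ^ j)"
    unfolding sum_negf[symmetric]
  proof (rule sum.cong)
    fix j assume "j \<in> {1..n}"
    then show "(l gchoose j) * (-1) ^ (j - 1) = - ((l gchoose j) * (-1) ^ j)"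
      by (cases j) auto
  qed simp
  also have "\<dots> = 1 - (\<Sum>j\<le>n. (l gchoose j) * (-1) ^ j)"
    by (simp add: sum.atLeast1_atMost_eq sum.atMost_shift)
  finally show ?thesis
    by (simp add: deg_harmonic_def gbinomial_sum_lower_neg mult.assoc sum_divide_distrib[symmetric])
qed

text \<open>Induction on the order: the hockey-stick identity sums the ordinary binomials, and the
  alternating sum again lowers the real upper argument by one.\<close>

lemma deg_hyperharmonic_closed_form:
  "deg_hyperharmonic l (Suc k) n =
    (real ((k + n) choose n) - (-1) ^ n * ((l - 1 - real k) gchoose n)) / l"
proof (induction k arbitrary: n)
  case 0
  show ?case by (simp add: deg_harmonic_closed_form)
next
  case (Suc k)
  let ?f = "\<lambda>j. (real ((k + j) choose j) - (-1) ^ j * ((l - 1 - real k) gchoose j)) / l"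
  have "deg_hyperharmonic l (Suc (Suc k)) n = (\<Sum>j = 1..n. ?f j)"
    by (simp add: Suc.IH)
  \<comment> \<open>Both binomials are 1 at \<open>j = 0\<close>, so
    \<open>?f 0 = 0\<close>.\<close>
  also have "\<dots> = (\<Sum>j\<le>n. ?f j)"
    by (simp add: sum.atLeast1_atMost_eq sum.atMost_shift)
  also have "\<dots> = (real (\<Sum>j\<le>n. (k + j) choose j)
      - (\<Sum>j\<le>n. ((l - 1 - real k) gchoose j) * (-1) ^ j)) / l"
    by (simp add: sum_divide_distrib[symmetric] sum_subtractf mult.commute)
  also have "\<dots> = (real ((Suc k + n) choose n)
      - (-1) ^ n * ((l - 1 - real (Suc k)) gchoose n)) / l"
    by (simp only: sum_choose_lower gbinomial_sum_lower_neg) (simp add: algebra_simps)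
  finally show ?case .
qed

theorem theorem3:
  fixes l :: real and n k :: nat
  assumes "l \<noteq> 0" and "n \<ge> 1" and "k \<ge> 1"
    and "(l - 1) gchoose k \<noteq> 0"
  shows "deg_hyperharmonic l (k + 1) n =
    (-1) ^ k / ((l - 1) gchoose k) * real ((n + k) choose n)
      * (deg_harmonic l (n + k) - deg_harmonic l k)"
proof -
  let ?b = "(l - 1) gchoose k" and ?c = "(l - 1) gchoose (n + k)"
  let ?d = "(l - 1 - real k) gchoose n" and ?m = "real ((n + k) choose n)"
  \<comment> \<open>Trinomial revision produces \<open>(n + k) choose k\<close>; symmetry turns it
    into \<open>?m\<close>.\<close>
  have "?c * ?m = ?b * ?d"
    using gbinomial_trinomial_revision[of k "n + k" "l - 1"] binomial_symmetric[of n "n + k"]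
    by (simp add: binomial_gbinomial)
  then have d: "?d = ?m * ?c / ?b"
    using assms(4) by (simp add: field_simps)
  have sq: "(-1) ^ k * (-1) ^ k = (1 :: real)"
    by (simp add: power_add[symmetric])
  \<comment> \<open>The constants \<open>1 / l\<close> cancel; the sign factored out will cancel the
    sign of the prefactor through \<open>sq\<close>.\<close>
  have "deg_harmonic l (n + k) - deg_harmonic l k = (-1) ^ k * (?b - (-1) ^ n * ?c) / l"
    by (simp add: deg_harmonic_closed_form power_add field_simps diff_divide_distrib)
  then have "(-1) ^ k / ?b * ?m * (deg_harmonic l (n + k) - deg_harmonic l k)
      = ((-1) ^ k * (-1) ^ k) * (?m / ?b * (?b - (-1) ^ n * ?c) / l)"
    by simp
  also have "\<dots> = (?m - (-1) ^ n * ?d) / l"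
    unfolding sq d using assms(4) by (simp add: field_simps)
  also have "\<dots> = deg_hyperharmonic l (k + 1) n"
    by (simp add: deg_hyperharmonic_closed_form add.commute)
  finally show ?thesis by simp
qed

end
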